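(* Let $k$ be a field of characteristic $p>0$ and let $l,m\ge1$, $t\ge2$ be integers with $mt\ge3$. In $k[x_1,x_2,x_3]$ put $f:=x_1x_3-x_2^t$, $r:=f^lx_2+x_1^m$, $g:=x_1^{-1}(f^{lt+1}+r^t)$, and let $\epsilon$ be the $\mathbf{G}_a$-action on $k[x_1,x_2,x_3]$ described in the context. Let $0\ne h\in k[x_1,x_2,x_3]^{\epsilon}$. Then: (i) if $p\nmid t$, then $\operatorname{pl}(\epsilon_h)$ is not a principal ideal of $k[x_1,x_2,x_3]^{\epsilon_h}$; (ii) if $p\mid t$, then $\operatorname{pl}(\epsilon_h)=gh\,k[x_1,x_2,x_3]^{\epsilon_h}$.
   Context: The element $g$ is a polynomial. The elements $f,g,r$ are algebraically independent over $k$, and, with $C:=k[f^{\pm1},g^{\pm1}]\subset k(x_1,x_2,x_3)$, one has $k[x_1,x_2,x_3]\subset C[r]$, where $C[r]$ is a polynomial ring in $r$ over $C$. Let $\tilde\epsilon:C[r]\to C[r][T]$ be the $C$-algebra homomorphism $u(r)\mapsto u(r+f^lgT)$; it maps $k[x_1,x_2,x_3]$ into $k[x_1,x_2,x_3][T]$, and $\epsilon$ denotes its restriction to $k[x_1,x_2,x_3]$, a $\mathbf{G}_a$-action. Here a $\mathbf{G}_a$-action on a $k$-algebra $B$ is a $k$-algebra homomorphism $\epsilon:B\to B[T]$ such that, writing $\epsilon(b)=\sum_i b_iT^i$, $b_0=b$ and $\sum_i\epsilon(b_i)U^i=\sum_ib_i(T+U)^i$ in $B[T,U]$; $B^{\epsilon}:=\{b\mid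 \epsilon(b)=b\}$. For $a\in B^{\epsilon}$, $\epsilon_a(b):=\epsilon(b)|_{T=a}$ defines an automorphism. For an automorphism $\phi$ of $B$, $B^{\phi}:=\{b\mid\phi(b)=b\}$ and $\operatorname{pl}(\phi):=\{\phi(b)-b\mid b\in B\}\cap B^{\phi}$, an ideal of $B^{\phi}$. *)

theory Defs
  imports "HOL-Computational_Algebra.Polynomial"
begin

text \<open>k[x1,x2,x3] is modelled as the iterated polynomial ring ('a poly) poly poly:
 x3 is the outermost variable, x1 the innermost.  B[T] is ('a poly poly poly) poly.\<close>

type_synonym 'a mpoly3 = "'a poly poly poly"

definition X1 :: "'a::comm_ring_1 mpoly3" where "X1 = [:[:[:0, 1:]:]:]"
definition X2 :: "'a::comm_ring_1 mpoly3" where "X2 = [:[:0, 1:]:]"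
definition X3 :: "'a::comm_ring_1 mpoly3" where "X3 = [:0, 1:]"
definition const3 :: "'a::comm_ring_1 \<Rightarrow> 'a mpoly3" where "const3 c = [:[:[:c:]:]:]"

definition fpol :: "nat \<Rightarrow> 'a::comm_ring_1 mpoly3" where
  "fpol t = X1 * X3 - X2 ^ t"
definition rpol :: "nat \<Rightarrow> nat \<Rightarrow> nat \<Rightarrow> 'a::comm_ring_1 mpoly3" where
  "rpol l m t = fpol t ^ l * X2 + X1 ^ m"
text \<open>g = x1^{-1}(f^{lt+1}+r^t); the division is exact (the paper notes g is a polynomial).\<close>
definition gpol :: "nat \<Rightarrow> nat \<Rightarrow> nat \<Rightarrow> 'a::field mpoly3" where
  "gpol l m t = (fpol t ^ (l * t + 1) + rpol l m t ^ t) div X1"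

definition kalg_hom_T :: "('a::comm_ring_1 mpoly3 \<Rightarrow> 'a mpoly3 poly) \<Rightarrow> bool" where
  "kalg_hom_T \<epsilon> \<longleftrightarrow> (\<forall>a b. \<epsilon> (a + b) = \<epsilon> a + \<epsilon> b) \<and> (\<forall>a b. \<epsilon> (a * b) = \<epsilon> a * \<epsilon> b)
     \<and> \<epsilon> 1 = 1 \<and> (\<forall>c. \<epsilon> (const3 c) = [:const3 c:])"

definition invariants :: "('b::comm_ring_1 \<Rightarrow> 'b poly) \<Rightarrow> 'b set" where
  "invariants \<epsilon> = {b. \<epsilon> b = [:b:]}"

definition eps_at :: "('b::comm_ring_1 \<Rightarrow> 'b poly) \<Rightarrow> 'b \<Rightarrow> 'b \<Rightarrow> 'b" where
  "eps_at \<epsilon> a b = poly (\<epsilon> b) a"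

definition fixring :: "('b \<Rightarrow> 'b) \<Rightarrow> 'b set" where
  "fixring \<phi> = {b. \<phi> b = b}"

definition pl :: "('b::ab_group_add \<Rightarrow> 'b) \<Rightarrow> 'b set" where
  "pl \<phi> = {\<phi> b - b | b. True} \<inter> fixring \<phi>"

definition principal_in :: "'b::comm_ring_1 set \<Rightarrow> 'b set \<Rightarrow> bool" where
  "principal_in A I \<longleftrightarrow> (\<exists>a\<in>A. I = {a * c | c. c \<in> A})"

end

theory Submission
  imports Defs "HOL-Computational_Algebra.Polynomial_Factorial"
begin

text \<open>
  Write \<open>\<phi> = \<epsilon>\<^sub>h\<close>, so that \<open>\<phi>\<close> fixes \<open>f\<close>, \<open>g\<close>, \<open>h\<close> and shifts \<open>r\<close> by \<open>s = f\<^sup>l g h\<close>. The norm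
  \<open>N\<close> of \<open>r\<close> is invariant and congruent to \<open>r\<^sup>p\<close> modulo \<open>s\<close>.

  If \<open>p\<close> divides \<open>t\<close>, then \<open>\<phi>\<close> is the identity modulo \<open>g h\<close>, and replacing \<open>x\<^sub>1\<close> in
  \<open>x\<^sub>2 = (r - x\<^sub>1\<^sup>m) / f\<^sup>l\<close> by an invariant congruent to it modulo \<open>f\<^sup>l\<close> gives an element shifted by
  exactly \<open>g h\<close>.

  If \<open>p\<close> does not divide \<open>t\<close>, then the plinth ideal contains \<open>s\<close> and some \<open>f\<^sup>j h\<close>, and, if
  moreover \<open>p\<close> does not divide \<open>m t - 1\<close>, also some \<open>g\<^sup>n h\<close>. Since \<open>f\<close> and \<open>g\<close> are coprime, a
  generator would have to divide \<open>f\<^sup>e h\<close>, where \<open>e = 0\<close> if \<open>p\<close> does not divide \<open>m t - 1\<close> and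
  \<open>e = l\<close> otherwise. But \<open>\<phi>\<close> moves every polynomial by an element of \<open>f\<^sup>e h M\<close>, where \<open>M\<close> is the
  maximal ideal of the origin, so \<open>f\<^sup>e h\<close> itself is not in the plinth ideal.
\<close>

section \<open>Generators of the polynomial ring and differences of powers\<close>

lemma mpoly3_induct [case_names const X1 X2 X3 add mult]:
  fixes b :: "'a::comm_ring_1 mpoly3"
  assumes const: "\<And>c. P (const3 c)" and X1: "P X1" and X2: "P X2" and X3: "P X3"
    and add: "\<And>u v. P u \<Longrightarrow> P v \<Longrightarrow> P (u + v)"
    and mult: "\<And>u v. P u \<Longrightarrow> P v \<Longrightarrow> P (u * v)"
  shows "P b"
proof -
  have const0: "P 0"
    using const[of 0] by (simp add: const3_def)
  have 1: "P [:[:u:]:]" for u :: "'a poly"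
  proof (induction u)
    case (pCons c u)
    have "[:[:pCons c u:]:] = const3 c + X1 * [:[:u:]:]"
      by (simp add: const3_def X1_def)
    with pCons show ?case by (simp only: const X1 add mult)
  qed (simp add: const0)
  have 2: "P [:u:]" for u :: "'a poly poly"
  proof (induction u)
    case (pCons c u)
    have "[:pCons c u:] = [:[:c:]:] + X2 * [:u:]"
      by (simp add: X2_def)
    with pCons show ?case by (simp only: 1 X2 add mult)
  qed (simp add: const0)
  show ?thesis
  proof (induction b)
    case (pCons c u)
    have "pCons c u = [:c:] + X3 * u"
      by (simp add: X3_def)
    with pCons show ?case by (simp only: 2 X3 add mult)
  qed (simp add: const0)
qed

text \<open>Taylor expansion of the difference quotient \<open>S\<close>: at \<open>x = y\<close> it
  is the derivative. Where \<open>n\<close> vanishes, \<open>S\<close> gains a factor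
  \<open>x - y\<close>.\<close>

lemma power_diff_second_order:
  fixes x y :: "'b::comm_ring_1"
  shows "\<exists>S q. x ^ n - y ^ n = (x - y) * S \<and> S = of_nat n * y ^ (n - 1) + (x - y) * q"
proof -
  have "x - y dvd y ^ (n - Suc i) * x ^ i - y ^ (n - 1)" if "i < n" for i
  proof -
    have "y ^ (n - 1) = y ^ (n - Suc i) * y ^ i"
      using that by (simp flip: power_add)
    then have "y ^ (n - Suc i) * x ^ i - y ^ (n - 1) = y ^ (n - Suc i) * (x ^ i - y ^ i)"
      by (simp add: algebra_simps)
    then show ?thesis
      by (simp add: power_diff_sumr2)
  qed
  then have "x - y dvd (\<Sum>i<n. y ^ (n - Suc i) * x ^ i - y ^ (n - 1))"
    by (intro dvd_sum) simp
  then obtain q where "(\<Sum>i<n. y ^ (n - Suc i) * x ^ i) - of_nat n * y ^ (n - 1) = (x - y) * q"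
    by (auto simp: sum_subtractf elim: dvdE)
  then have "(\<Sum>i<n. y ^ (n - Suc i) * x ^ i) = of_nat n * y ^ (n - 1) + (x - y) * q"
    by (simp add: algebra_simps)
  then show ?thesis
    using power_diff_sumr2[of x n y] by blast
qed

text \<open>Only the summand \<open>x ^ (n - 1)\<close> of the difference quotient is free of
  \<open>y\<close>. It will be applied to \<open>x = r\<close> and \<open>y = f ^ l * X2\<close>,
  whose difference is \<open>X1 ^ m\<close>.\<close>

lemma power_diff_leading:
  fixes x y :: "'b::comm_ring_1"
  assumes "n \<ge> 1"
  shows "\<exists>q. x ^ n - y ^ n = (x - y) * (x ^ (n - 1) + y * q)"
proof -
  have "y dvd (\<Sum>i<n - 1. y ^ (n - Suc i) * x ^ i)"
    by (intro dvd_sum dvd_mult2 dvd_power) auto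
  then obtain q where q: "(\<Sum>i<n - 1. y ^ (n - Suc i) * x ^ i) = y * q" ..
  have "{..<n} = {..<Suc (n - 1)}"
    using assms by simp
  then have "(\<Sum>i<n. y ^ (n - Suc i) * x ^ i) = x ^ (n - 1) + y * q"
    using q assms by (simp only: sum.lessThan_Suc) simp
  then show ?thesis
    using power_diff_sumr2[of x n y] by auto
qed

lemma prod_arith_progression_cong:
  fixes r s :: "'b::comm_ring_1"
  shows "s dvd (\<Prod>i<n. r + of_nat i * s) - r ^ n"
proof (induction n)
  case (Suc n)
  then obtain q where "(\<Prod>i<n. r + of_nat i * s) - r ^ n = s * q" ..
  then have "(\<Prod>i<n. r + of_nat i * s) = r ^ n + s * q"
    by (simp add: algebra_simps)
  then have "(\<Prod>i<Suc n. r + of_nat i * s) - r ^ Suc n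
      = s * (of_nat n * r ^ n + q * (r + of_nat n * s))"
    by (simp add: algebra_simps)
  then show ?case by simp
qed simp

lemma dvd_diff_power:
  fixes x y :: "'b::comm_ring_1"
  assumes "d dvd x - y"
  shows "d dvd x ^ n - y ^ n"
  using assms by (simp add: power_diff_sumr2)

section \<open>Expansions of \<open>g\<close> and divisibility by \<open>X1\<close>\<close>

lemma prime_elem_X1: "prime_elem (X1 :: 'a::field mpoly3)"
  unfolding X1_def by (intro lift_prime_elem_poly prime_elem_linear_field_poly) simp

lemma X1_nonzero: "(X1 :: 'a::field mpoly3) \<noteq> 0"
  by (simp add: X1_def)

text \<open>Rests on \<open>X1 * X3 = f + X2 ^ t\<close>. The quotient \<open>S\<close> is left open
  so that different expansions of the power difference can be inserted.\<close>

lemma gpol_eq: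
  fixes S :: "'a::field mpoly3"
  assumes "l \<ge> 1" "m \<ge> 1"
    and S: "X1 ^ m * S = rpol l m t ^ t - (fpol t ^ l * X2) ^ t"
  shows "gpol l m t = fpol t ^ (l * t) * X3 + X1 ^ (m - 1) * S"
    and "X1 * gpol l m t = (fpol t ^ (l * t + 1) + rpol l m t ^ t :: 'a mpoly3)"
proof -
  have "X1 ^ m = (X1 * X1 ^ (m - 1) :: 'a mpoly3)"
    using \<open>m \<ge> 1\<close> by (simp flip: power_Suc)
  then have "X1 * (fpol t ^ (l * t) * X3 + X1 ^ (m - 1) * S)
      = fpol t ^ (l * t) * (X1 * X3) + X1 ^ m * S"
    by (simp add: algebra_simps)
  also have "\<dots> = fpol t ^ (l * t) * (fpol t + X2 ^ t) + (rpol l m t ^ t - (fpol t ^ l * X2) ^ t)"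
    by (simp add: S) (simp add: fpol_def)
  also have "\<dots> = fpol t ^ (l * t + 1) + rpol l m t ^ t"
    by (simp add: algebra_simps power_mult_distrib power_mult)
  finally have *: "X1 * (fpol t ^ (l * t) * X3 + X1 ^ (m - 1) * S)
      = fpol t ^ (l * t + 1) + rpol l m t ^ t" .
  then show 1: "gpol l m t = fpol t ^ (l * t) * X3 + X1 ^ (m - 1) * S"
    unfolding gpol_def by (metis X1_nonzero nonzero_mult_div_cancel_left)
  show "X1 * gpol l m t = (fpol t ^ (l * t + 1) + rpol l m t ^ t :: 'a mpoly3)"
    using * 1 by simp
qed

lemma rpol_minus: "rpol l m t - fpol t ^ l * X2 = (X1 ^ m :: 'a::field mpoly3)"
  by (simp add: rpol_def)

lemma X1_mult_gpol:
  assumes "l \<ge> 1" "m \<ge> 1"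
  shows "X1 * gpol l m t = (fpol t ^ (l * t + 1) + rpol l m t ^ t :: 'a::field mpoly3)"
proof -
  obtain S :: "'a mpoly3" where "rpol l m t ^ t - (fpol t ^ l * X2) ^ t = X1 ^ m * S"
    using power_diff_second_order[of "rpol l m t :: 'a mpoly3" t "fpol t ^ l * X2"]
    unfolding rpol_minus by blast
  with gpol_eq(2)[OF assms] show ?thesis by metis
qed

lemma gpol_expansion:
  assumes "l \<ge> 1" "m \<ge> 1" "t \<ge> 1"
  shows "\<exists>q :: 'a::field mpoly3. gpol l m t = fpol t ^ (l * t) * X3
    + X1 ^ (m - 1) * (rpol l m t ^ (t - 1) + fpol t ^ l * X2 * q)"
proof -
  obtain q :: "'a mpoly3" where "rpol l m t ^ t - (fpol t ^ l * X2) ^ t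
      = X1 ^ m * (rpol l m t ^ (t - 1) + fpol t ^ l * X2 * q)"
    using power_diff_leading[of t "rpol l m t :: 'a mpoly3" "fpol t ^ l * X2"] assms
    unfolding rpol_minus by blast
  with gpol_eq(1)[OF assms(1,2)] show ?thesis by metis
qed

text \<open>A point of the plane \<open>X1 = 0\<close> at which \<open>f\<close> has the value -1,
  so that a nonzero value refutes divisibility by \<open>X1\<close>.\<close>

definition ev011 :: "'a::comm_ring_1 mpoly3 \<Rightarrow> 'a" where
  "ev011 b = poly (poly (poly b 1) 1) 0"

lemma ev011_simps [simp]:
  "ev011 (u + v) = ev011 u + ev011 v" "ev011 (u - v) = ev011 u - ev011 v"
  "ev011 (u * v) = ev011 u * ev011 v" "ev011 (u ^ n) = ev011 u ^ n"
  "ev011 X1 = 0" "ev011 X2 = 1" "ev011 X3 = 1"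
  by (auto simp: ev011_def X1_def X2_def X3_def)

lemma not_X1_dvd: "ev011 b \<noteq> 0 \<Longrightarrow> \<not> X1 dvd b"
  by (auto elim!: dvdE)

lemma not_X1_dvd_fpol:
  assumes "t \<ge> 1" shows "\<not> X1 dvd (fpol t :: 'a::field mpoly3)"
  using assms by (intro not_X1_dvd) (simp add: fpol_def)

text \<open>As \<open>t\<close> vanishes in k, the difference quotient of the \<open>t\<close>-th
  power gains a factor \<open>X1 ^ m\<close>. Modulo \<open>X1\<close> only the term with
  \<open>X3\<close> is left.\<close>

lemma not_X1_dvd_gpol:
  assumes "l \<ge> 1" "m \<ge> 1" "t \<ge> 1" and t0: "of_nat t = (0 :: 'a::field)"
  shows "\<not> X1 dvd (gpol l m t :: 'a mpoly3)"
proof -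
  have t0': "of_nat t = (0 :: 'a mpoly3)"
    using t0 by (simp add: of_nat_eq_0_iff_char_dvd)
  obtain q :: "'a mpoly3" where "rpol l m t ^ t - (fpol t ^ l * X2) ^ t = X1 ^ m * (X1 ^ m * q)"
    using power_diff_second_order[of "rpol l m t :: 'a mpoly3" t "fpol t ^ l * X2"]
    unfolding rpol_minus t0' by auto
  then have "gpol l m t = fpol t ^ (l * t) * X3 + X1 ^ (m - 1) * (X1 ^ m * q)"
    using gpol_eq(1)[OF assms(1,2)] by metis
  then show ?thesis
    using assms by (intro not_X1_dvd) (simp add: fpol_def zero_power)
qed

text \<open>Restriction to the \<open>X1\<close>-axis, where \<open>f\<close> vanishes and
  \<open>r\<close> becomes the \<open>m\<close>-th power of the coordinate; powers of
  \<open>[:0, 1:]\<close> measure vanishing at the origin.\<close>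

definition res1 :: "'a::comm_ring_1 mpoly3 \<Rightarrow> 'a poly" where
  "res1 b = poly (poly b 0) 0"

lemma res1_simps [simp]:
  "res1 (u + v) = res1 u + res1 v" "res1 (u - v) = res1 u - res1 v"
  "res1 (u * v) = res1 u * res1 v" "res1 (u ^ n) = res1 u ^ n"
  "res1 0 = 0" "res1 1 = 1" "res1 (of_nat k) = of_nat k"
  "res1 X1 = [:0, 1:]" "res1 X2 = 0" "res1 X3 = 0"
  by (auto simp: res1_def X1_def X2_def X3_def)

lemma res1_fpol [simp]: "t \<ge> 1 \<Longrightarrow> res1 (fpol t) = 0"
  by (simp add: fpol_def zero_power)

lemma res1_rpol [simp]: "t \<ge> 1 \<Longrightarrow> l \<ge> 1 \<Longrightarrow> res1 (rpol l m t) = [:0, 1:] ^ m"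
  by (simp add: rpol_def)

lemma res1_gpol [simp]:
  assumes "l \<ge> 1" "m \<ge> 1" "t \<ge> 1"
  shows "res1 (gpol l m t :: 'a::field mpoly3) = [:0, 1:] ^ (m * t - 1)"
proof -
  have "m - 1 + m * (t - 1) = m * t - 1"
    using assms by (cases m; cases t) auto
  moreover obtain q :: "'a mpoly3" where "gpol l m t = fpol t ^ (l * t) * X3
    + X1 ^ (m - 1) * (rpol l m t ^ (t - 1) + fpol t ^ l * X2 * q)"
    using gpol_expansion[OF assms] by blast
  ultimately show ?thesis
    using assms by (simp flip: power_mult power_add)
qed

lemma prime_elem_dvd_cancel:
  fixes q :: "'b::idom"
  assumes "prime_elem q" "\<not> q dvd a" "a dvd q * u"
  shows "a dvd u"
proof -
  from \<open>a dvd q * u\<close> obtain v where v: "q * u = a * v" ..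
  then have "q dvd v"
    using assms by (metis dvd_triv_left prime_elem_dvd_mult_iff)
  then obtain w where "v = q * w" ..
  with v have "q * u = q * (a * w)"
    by (simp add: mult_ac)
  then have "u = a * w"
    using assms(1) by (metis mult_left_cancel prime_elem_not_zeroI)
  then show ?thesis by simp
qed

lemma of_nat_mpoly3_eq_0_iff: "of_nat n = (0 :: 'a::comm_ring_1 mpoly3) \<longleftrightarrow> CHAR('a) dvd n"
  by (simp add: of_nat_eq_0_iff_char_dvd)

lemma fpol_nonzero:
  assumes "t \<ge> 1" shows "(fpol t :: 'a::field mpoly3) \<noteq> 0"
  using not_X1_dvd_fpol[OF assms] by (metis dvd_0_right)

lemma gpol_nonzero:
  assumes "l \<ge> 1" "m \<ge> 1" "t \<ge> 1" shows "(gpol l m t :: 'a::field mpoly3) \<noteq> 0"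
proof
  assume "gpol l m t = (0 :: 'a mpoly3)"
  then have "res1 (gpol l m t :: 'a mpoly3) = 0" by simp
  then show False
    using assms by simp
qed

section \<open>The automorphism and its invariant norm\<close>

locale freudenburg_automorphism =
  fixes \<phi> :: "'a::field mpoly3 \<Rightarrow> 'a mpoly3" and l m t p :: nat and h :: "'a mpoly3"
  assumes char: "CHAR('a) = p" "p > 0"
    and params: "l \<ge> 1" "m \<ge> 1" "t \<ge> 2" "m * t \<ge> 3"
    and hom_add: "\<phi> (u + v) = \<phi> u + \<phi> v"
    and hom_mult: "\<phi> (u * v) = \<phi> u * \<phi> v"
    and hom_const: "\<phi> (const3 c) = const3 c"
    and fix_f: "\<phi> (fpol t) = fpol t"
    and fix_g: "\<phi> (gpol l m t) = gpol l m t"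
    and fix_h: "\<phi> h = h"
    and shift_r: "\<phi> (rpol l m t) = rpol l m t + fpol t ^ l * gpol l m t * h"
    and h_nonzero: "h \<noteq> 0"
    and h_dvd: "h dvd \<phi> b - b"
begin

abbreviation f :: "'a mpoly3" where "f \<equiv> fpol t"
abbreviation g :: "'a mpoly3" where "g \<equiv> gpol l m t"
abbreviation r :: "'a mpoly3" where "r \<equiv> rpol l m t"
abbreviation s :: "'a mpoly3" where "s \<equiv> f ^ l * g * h"

lemma t_ge_1: "t \<ge> 1"
  using params by simp

lemma prime_p: "prime p"
  using char prime_CHAR_semidom by metis

lemma hom_1: "\<phi> 1 = 1"
  using hom_const[of 1] by (simp add: const3_def one_pCons)

lemma hom_diff: "\<phi> (u - v) = \<phi> u - \<phi> v"
  using hom_add[of "u - v" v] by (simp add: algebra_simps)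

lemma hom_minus: "\<phi> (- u) = - \<phi> u"
  using hom_diff[of 0 u] hom_diff[of 0 0] by simp

lemma hom_power: "\<phi> (u ^ n) = \<phi> u ^ n"
  by (induction n) (simp_all add: hom_1 hom_mult)

lemma hom_of_nat: "\<phi> (of_nat n) = of_nat n"
  using hom_diff[of 0 0] by (induction n) (simp_all add: hom_add hom_1)

lemma hom_prod: "\<phi> (prod u A) = (\<Prod>i\<in>A. \<phi> (u i))"
  by (induction A rule: infinite_finite_induct) (simp_all add: hom_1 hom_mult)

lemmas hom_simps = hom_add hom_mult hom_diff hom_power hom_1 hom_of_nat hom_minus
  hom_prod fix_f fix_g fix_h shift_r

lemma fix_fl: "\<phi> (f ^ n) = f ^ n"
  by (simp add: hom_simps)

lemma f_nonzero: "f \<noteq> 0"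
  using fpol_nonzero t_ge_1 .

lemma g_nonzero: "g \<noteq> 0"
  using gpol_nonzero params(1,2) t_ge_1 .

lemma X1_g: "X1 * g = f ^ (l * t + 1) + r ^ t"
  using X1_mult_gpol params by blast

definition N :: "'a mpoly3" where "N = (\<Prod>i<p. r + of_nat i * s)"

text \<open>\<open>\<phi>\<close> moves each factor to the next and the last one back to
  \<open>r\<close>, because \<open>p * s = 0\<close>.\<close>

lemma fix_N: "\<phi> N = N"
proof -
  have p0: "of_nat p = (0 :: 'a mpoly3)"
    by (simp add: of_nat_mpoly3_eq_0_iff char)
  obtain n where n: "p = Suc n"
    using char by (cases p) auto
  have "\<phi> N = (\<Prod>i<p. r + of_nat (Suc i) * s)"
    by (simp add: N_def hom_simps algebra_simps)
  also have "\<dots> = (\<Prod>i<n. r + of_nat (Suc i) * s) * (r + of_nat p * s)"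
    by (simp only: n prod.lessThan_Suc)
  also have "\<dots> = (\<Prod>i<n. r + of_nat (Suc i) * s) * (r + of_nat 0 * s)"
    by (simp only: p0 of_nat_0)
  also have "\<dots> = N"
    unfolding N_def unfolding n by (simp only: prod.lessThan_Suc_shift mult.commute)
  finally show ?thesis .
qed

lemma N_cong: "s dvd N - r ^ p"
  unfolding N_def by (rule prod_arith_progression_cong)

section \<open>Coprimality of \<open>f\<close> and \<open>g\<close>\<close>

lemma f_dvd_g: "f ^ l dvd g - X1 ^ (m * t - 1)"
proof -
  obtain q :: "'a mpoly3" where q: "g = f ^ (l * t) * X3
    + X1 ^ (m - 1) * (r ^ (t - 1) + f ^ l * X2 * q)"
    using gpol_expansion[of l m t] params t_ge_1 by blast
  have "m * t - 1 = m - 1 + m * (t - 1)"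
    using params by (cases m; cases t) auto
  then have X1_pow: "X1 ^ (m * t - 1) = X1 ^ (m - 1) * ((X1 ^ m) ^ (t - 1) :: 'a mpoly3)"
    by (simp only: power_add power_mult)
  have "f ^ l dvd f ^ (l * t)"
    using t_ge_1 by (intro le_imp_power_dvd) simp
  moreover have "f ^ l dvd r ^ (t - 1) - (X1 ^ m) ^ (t - 1)"
    by (intro dvd_diff_power) (simp add: rpol_def)
  moreover have "g - X1 ^ (m * t - 1) = f ^ (l * t) * X3
    + X1 ^ (m - 1) * (r ^ (t - 1) - (X1 ^ m) ^ (t - 1)) + f ^ l * (X1 ^ (m - 1) * X2 * q)"
    unfolding q X1_pow by (simp add: algebra_simps)
  ultimately show ?thesis
    by (simp add: dvd_add)
qed

lemma f_dvd_X1_power_cancel: "f dvd X1 ^ n * u \<Longrightarrow> f dvd u"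
proof (induction n)
  case (Suc n)
  then have "f dvd X1 * (X1 ^ n * u)"
    by (simp add: mult.assoc)
  from prime_elem_dvd_cancel[OF prime_elem_X1 not_X1_dvd_fpol[OF t_ge_1] this] Suc.IH
  show ?case by blast
qed simp

text \<open>Modulo \<open>f\<close>, \<open>g\<close> is a power of the prime \<open>X1\<close>,
  which does not divide \<open>f\<close>. Hence the factors \<open>f\<close> can be split off from
  \<open>u\<close> one at a time.\<close>

lemma f_power_dvd_g_cancel: "f ^ k dvd g * u \<Longrightarrow> f ^ k dvd u"
proof (induction k arbitrary: u)
  case (Suc k)
  have "f dvd f ^ l"
    using params by (intro dvd_power) simp
  then have "f dvd g - X1 ^ (m * t - 1)"
    using f_dvd_g by (rule dvd_trans)
  then have "f dvd (g - X1 ^ (m * t - 1)) * u"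
    by (rule dvd_mult2)
  moreover have "f dvd g * u"
    using Suc.prems dvd_mult_left[of f "f ^ k" "g * u"] by simp
  ultimately have "f dvd g * u - (g - X1 ^ (m * t - 1)) * u"
    by (intro dvd_diff)
  also have "g * u - (g - X1 ^ (m * t - 1)) * u = X1 ^ (m * t - 1) * u"
    by (simp add: left_diff_distrib)
  finally obtain v where v: "u = f * v"
    using f_dvd_X1_power_cancel by (blast elim: dvdE)
  have "f * f ^ k dvd f * (g * v)"
    using Suc.prems v by (simp add: mult_ac)
  then have "f ^ k dvd g * v"
    using f_nonzero dvd_mult_cancel_left[of f "f ^ k" "g * v"] by blast
  with Suc.IH have "f ^ k dvd v" by blast
  then show ?case
    unfolding v by (simp add: mult_dvd_mono)
qed simp

lemma f_power_dvd_g_power_cancel: "f ^ k dvd g ^ n * u \<Longrightarrow> f ^ k dvd u"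
proof (induction n)
  case (Suc n)
  then have "f ^ k dvd g * (g ^ n * u)"
    by (simp add: mult.assoc)
  with f_power_dvd_g_cancel Suc.IH show ?case by blast
qed simp

section \<open>Elements of the plinth ideal\<close>

lemma plI: "\<phi> b - b = c \<Longrightarrow> \<phi> c = c \<Longrightarrow> c \<in> pl \<phi>"
  unfolding pl_def by (auto simp: fixring_def)

lemma fix_cancel: "\<phi> a = a \<Longrightarrow> \<phi> (a * c) = a * c \<Longrightarrow> a \<noteq> 0 \<Longrightarrow> \<phi> c = c"
  by (simp add: hom_mult)

lemma s_in_pl: "s \<in> pl \<phi>"
  by (rule plI[of r]) (simp_all add: hom_simps)

text \<open>Since \<open>N \<equiv> r\<^sup>p\<close> and \<open>r\<^sup>t\<close> is minus a power of \<open>f\<close> modulo \<open>g\<close>, inverting \<open>p\<close> modulo \<open>t\<close> makes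
  \<open>r\<close> times an \<open>f\<close>-power congruent to an invariant modulo \<open>g\<close>.\<close>
lemma f_power_h_in_pl:
  assumes "\<not> p dvd t"
  shows "\<exists>J. f ^ (J + l) * h \<in> pl \<phi>"
proof -
  have "gcd p t = 1"
    using assms prime_p by (simp add: prime_imp_coprime)
  then obtain i j where ij: "p * i = t * j + 1"
    using bezout_nat[of p t] char by auto
  define J where "J = (l * t + 1) * j"
  have "r ^ t - - (f ^ (l * t + 1)) = g * X1"
    unfolding mult.commute[of g] X1_g by simp
  then have "g dvd (r ^ t) ^ j - (- (f ^ (l * t + 1))) ^ j"
    by (intro dvd_diff_power) simp
  then have 1: "g dvd (r ^ t) ^ j * r - (- (f ^ (l * t + 1))) ^ j * r"
    unfolding left_diff_distrib[symmetric] by (rule dvd_mult2)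
  have "g dvd N - r ^ p"
    using N_cong dvd_trans[of g s] by simp
  then have "g dvd N ^ i - (r ^ p) ^ i"
    by (rule dvd_diff_power)
  moreover have "(r ^ p) ^ i = (r ^ t) ^ j * r"
    by (simp flip: power_mult add: ij)
  ultimately have "g dvd N ^ i - (- (f ^ (l * t + 1))) ^ j * r"
    using dvd_add[OF _ 1, of "N ^ i - (r ^ p) ^ i"] by simp
  moreover have "(- (f ^ (l * t + 1))) ^ j = (- 1) ^ j * f ^ J"
    unfolding J_def power_mult by (rule power_minus)
  ultimately have "g dvd N ^ i - (- 1) ^ j * f ^ J * r"
    by (simp only:)
  then obtain b where b: "N ^ i - (- 1) ^ j * f ^ J * r = g * b" ..
  have "g * (\<phi> b - b) = \<phi> (g * b) - g * b"
    by (simp add: hom_simps algebra_simps)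
  also have "\<dots> = g * (- ((- 1) ^ j * f ^ (J + l) * h))"
    unfolding b[symmetric] by (simp add: hom_simps fix_N power_add algebra_simps)
  finally have "\<phi> b - b = - ((- 1) ^ j * f ^ (J + l) * h)"
    using g_nonzero by (metis mult_left_cancel)
  \<comment> \<open>The sign is its own inverse, so it can be absorbed into the witness.\<close>
  moreover have "(- 1) ^ j * (- 1) ^ j = (1 :: 'a mpoly3)"
    by (simp flip: power_mult_distrib)
  moreover have "\<phi> ((- 1) ^ Suc j * b) - (- 1) ^ Suc j * b = (- 1) ^ Suc j * (\<phi> b - b)"
    by (simp add: hom_simps algebra_simps)
  ultimately have "\<phi> ((- 1) ^ Suc j * b) - (- 1) ^ Suc j * b = f ^ (J + l) * h"
    by (simp flip: mult.assoc)
  then have "f ^ (J + l) * h \<in> pl \<phi>"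
    by (rule plI) (simp add: hom_simps)
  then show ?thesis ..
qed

text \<open>Modulo \<open>f\<^sup>l\<close> one has \<open>r \<equiv> x\<^sub>1\<^sup>m\<close> and \<open>g \<equiv> x\<^sub>1\<^bsup>mt - 1\<^esup>\<close>, so inverting \<open>p\<close> modulo \<open>m t - 1\<close>
  makes \<open>r\<close> times a \<open>g\<close>-power congruent to an invariant modulo \<open>f\<^sup>l\<close>.\<close>
lemma g_power_h_in_pl:
  assumes "\<not> p dvd m * t - 1"
  shows "\<exists>n. g ^ n * h \<in> pl \<phi>"
proof -
  have "gcd p (m * t - 1) = 1"
    using assms prime_p by (metis coprime_iff_gcd_eq_1 prime_imp_coprime)
  then obtain u v where uv: "p * u = (m * t - 1) * v + 1"
    using bezout_nat[of p "m * t - 1"] char by auto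
  \<comment> \<open>Chosen so that \<open>m * p * u = (m * t - 1) * i + m\<close>; then
    \<open>N ^ u\<close> and \<open>g ^ i * r\<close> reduce to the same power of \<open>X1\<close>
    modulo \<open>f ^ l\<close>.\<close>
  define i where "i = m * v"
  have r1: "f ^ l dvd r - X1 ^ m"
    by (simp add: rpol_def)
  have "f ^ l dvd (N - r ^ p) + (r ^ p - (X1 ^ m) ^ p)"
    using N_cong dvd_trans[of "f ^ l" s] dvd_diff_power[OF r1] by (intro dvd_add) simp_all
  then have "f ^ l dvd N ^ u - ((X1 ^ m) ^ p) ^ u"
    by (intro dvd_diff_power) simp
  moreover have "f ^ l dvd (g ^ i - (X1 ^ (m * t - 1)) ^ i) * r + (X1 ^ (m * t - 1)) ^ i * (r - X1 ^ m)"
    using dvd_diff_power[OF f_dvd_g] r1 by simp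
  moreover have "((X1 ^ m) ^ p) ^ u = ((X1 ^ (m * t - 1)) ^ i * X1 ^ m :: 'a mpoly3)"
  proof -
    have "m * p * u = m * (p * u)"
      by simp
    also have "\<dots> = (m * t - 1) * i + m"
      unfolding uv i_def by (simp add: algebra_simps)
    finally show ?thesis
      by (simp flip: power_mult power_add)
  qed
  ultimately have "f ^ l dvd (g ^ i - (X1 ^ (m * t - 1)) ^ i) * r + (X1 ^ (m * t - 1)) ^ i * (r - X1 ^ m)
      - (N ^ u - (X1 ^ (m * t - 1)) ^ i * X1 ^ m)"
    by (simp only: dvd_diff)
  then have "f ^ l dvd g ^ i * r - N ^ u"
    by (simp add: algebra_simps)
  then obtain b where b: "g ^ i * r - N ^ u = f ^ l * b" ..
  have "f ^ l * (\<phi> b - b) = \<phi> (f ^ l * b) - f ^ l * b"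
    by (simp add: hom_simps algebra_simps)
  also have "\<dots> = f ^ l * (g ^ Suc i * h)"
    unfolding b[symmetric] by (simp add: hom_simps fix_N algebra_simps)
  finally have "\<phi> b - b = g ^ Suc i * h"
    using f_nonzero by (metis mult_left_cancel power_not_zero)
  then have "g ^ Suc i * h \<in> pl \<phi>"
    by (rule plI) (simp add: hom_simps)
  then show ?thesis ..
qed

text \<open>Comparing the cofactors of a generator gives \<open>g ^ n * c1 = f ^ J * c2\<close>, so
  coprimality lets \<open>f ^ J\<close> be cancelled from
  \<open>f ^ (J + e) * h = a * c1\<close>.\<close>

lemma principal_absorb:
  assumes "principal_in (fixring \<phi>) (pl \<phi>)"
    and "f ^ (J + e) * h \<in> pl \<phi>" and "f ^ e * g ^ n * h \<in> pl \<phi>"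
  shows "f ^ e * h \<in> pl \<phi>"
proof -
  obtain a where a: "\<phi> a = a" and pl: "pl \<phi> = {a * c | c. c \<in> fixring \<phi>}"
    using assms(1) unfolding principal_in_def fixring_def by blast
  obtain c1 c2 where c1: "f ^ (J + e) * h = a * c1" and c2: "f ^ e * g ^ n * h = a * c2"
    using assms(2,3) pl by blast
  have "a \<noteq> 0"
    using c1 f_nonzero h_nonzero by auto
  have "a * (g ^ n * c1) = g ^ n * (f ^ (J + e) * h)"
    using c1 by (simp add: mult_ac)
  also have "\<dots> = f ^ J * (f ^ e * g ^ n * h)"
    by (simp add: power_add mult_ac)
  also have "\<dots> = a * (f ^ J * c2)"
    using c2 by (simp add: mult_ac)
  finally have "g ^ n * c1 = f ^ J * c2"
    using \<open>a \<noteq> 0\<close> by (metis mult_left_cancel)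
  then have "f ^ J dvd c1"
    using f_power_dvd_g_power_cancel by (metis dvd_triv_left)
  then obtain c where c: "c1 = f ^ J * c" ..
  have "f ^ J * (f ^ e * h) = f ^ J * (a * c)"
    using c1 c by (simp add: power_add mult_ac)
  then have eq: "f ^ e * h = a * c"
    using f_nonzero by (metis mult_left_cancel power_not_zero)
  have "\<phi> (a * c) = a * c"
    unfolding eq[symmetric] by (simp add: hom_simps)
  then have "\<phi> c = c"
    using fix_cancel a \<open>a \<noteq> 0\<close> by blast
  then show ?thesis
    unfolding pl eq by (auto simp: fixring_def)
qed

section \<open>Elements outside the plinth ideal\<close>

lemma X1_X3: "X1 * X3 = f + X2 ^ t"
  by (simp add: fpol_def)

text \<open>Compares \<open>X1 * X3 = f + X2 ^ t\<close> with its image under \<open>\<phi>\<close>,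
  which fixes \<open>f\<close>.\<close>

lemma X1_mult_X3_diff:
  assumes "\<phi> X1 - X1 = h * u1" "\<phi> X2 - X2 = h * u2" "\<phi> X3 - X3 = h * u3"
  shows "\<exists>S. X1 * u3 = u2 * S - u1 * \<phi> X3"
proof -
  obtain S where S: "\<phi> X2 ^ t - X2 ^ t = (\<phi> X2 - X2) * S"
    using power_diff_sumr2 by blast
  have "\<phi> X1 * \<phi> X3 = f + \<phi> X2 ^ t"
    using arg_cong[OF X1_X3, of \<phi>] by (simp add: hom_simps)
  then have shift: "\<phi> X1 * \<phi> X3 - X1 * X3 = h * u2 * S"
    using S by (simp add: X1_X3 assms)
  have "h * (X1 * u3) = X1 * (\<phi> X3 - X3)"
    by (simp add: assms)
  also have "\<dots> = (\<phi> X1 * \<phi> X3 - X1 * X3) - (\<phi> X1 - X1) * \<phi> X3"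
    by (simp add: algebra_simps)
  also have "\<dots> = h * (u2 * S - u1 * \<phi> X3)"
    unfolding shift assms(1) by (simp add: algebra_simps)
  finally have "h * (X1 * u3) = h * (u2 * S - u1 * \<phi> X3)" .
  then have "X1 * u3 = u2 * S - u1 * \<phi> X3"
    using h_nonzero by simp
  then show ?thesis ..
qed

text \<open>Divisibility of \<open>res1 w\<close> by \<open>x\<^sub>1\<close> says that \<open>w\<close> vanishes at the origin. The squares are needed
  because the bound for \<open>x\<^sub>3\<close> comes from \<open>x\<^sub>1 x\<^sub>3 = f + x\<^sub>2\<^sup>t\<close> and loses one factor \<open>x\<^sub>1\<close>.\<close>
lemma diff_divisible:
  assumes w1: "\<phi> X1 - X1 = f ^ e * h * w1" "[:0, 1:] ^ 2 dvd res1 w1"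
    and w2: "\<phi> X2 - X2 = f ^ e * h * w2" "[:0, 1:] ^ 2 dvd res1 w2"
  shows "\<exists>w. \<phi> b - b = f ^ e * h * w \<and> [:0, 1:] dvd res1 w"
proof (induction b rule: mpoly3_induct)
  case (const c)
  show ?case by (rule exI[of _ 0]) (simp add: hom_const)
next
  case X1
  show ?case
    using w1 by (metis dvd_mult_left power2_eq_square)
next
  case X2
  show ?case
    using w2 by (metis dvd_mult_left power2_eq_square)
next
  case X3
  obtain v where v: "\<phi> X3 - X3 = h * v"
    using h_dvd by (blast elim: dvdE)
  obtain S where "X1 * v = (f ^ e * w2) * S - (f ^ e * w1) * \<phi> X3"
    using X1_mult_X3_diff[of "f ^ e * w1" "f ^ e * w2" v] w1(1) w2(1) v by (auto simp: mult_ac)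
  then have X1v: "X1 * v = f ^ e * (w2 * S - w1 * \<phi> X3)"
    by (simp add: algebra_simps)
  \<comment> \<open>The relation bounds only \<open>X1 * v\<close>; primality of \<open>X1\<close>
    passes the factor \<open>f ^ e\<close> on to \<open>v\<close>.\<close>
  have "\<not> X1 dvd f ^ e"
    using prime_elem_dvd_power[OF prime_elem_X1] not_X1_dvd_fpol[OF t_ge_1] by blast
  then have "f ^ e dvd v"
    using prime_elem_dvd_cancel[OF prime_elem_X1, of "f ^ e" v] X1v by simp
  then obtain w where w: "v = f ^ e * w" ..
  have "f ^ e * (X1 * w) = f ^ e * (w2 * S - w1 * \<phi> X3)"
    using X1v w by (simp add: mult_ac)
  then have "X1 * w = w2 * S - w1 * \<phi> X3"
    using f_nonzero by simp
  from arg_cong[OF this, of res1]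
  have "[:0, 1:] * res1 w = res1 w2 * res1 S - res1 w1 * res1 (\<phi> X3)"
    by (simp only: res1_simps)
  moreover have "[:0, 1:] * [:0, 1:] dvd res1 w2 * res1 S - res1 w1 * res1 (\<phi> X3)"
    using w1(2) w2(2) unfolding power2_eq_square by (intro dvd_diff dvd_mult2)
  ultimately have "[:0, 1:] * [:0, 1:] dvd [:0, 1:] * res1 w"
    by simp
  then have "[:0, 1:] dvd res1 w"
    unfolding dvd_mult_cancel_left by simp
  then show ?case
    using v w by (intro exI[of _ w]) (simp add: mult_ac)
next
  case (add u v)
  then obtain wu wv where
    u: "\<phi> u - u = f ^ e * h * wu" "[:0, 1:] dvd res1 wu" and
    v: "\<phi> v - v = f ^ e * h * wv" "[:0, 1:] dvd res1 wv" by blast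
  have "\<phi> (u + v) - (u + v) = (\<phi> u - u) + (\<phi> v - v)"
    by (simp add: hom_add)
  also have "\<dots> = f ^ e * h * (wu + wv)"
    unfolding u v by (simp add: algebra_simps)
  finally show ?case
    using u v by (intro exI[of _ "wu + wv"]) (simp add: dvd_add)
next
  case (mult u v)
  then obtain wu wv where
    u: "\<phi> u - u = f ^ e * h * wu" "[:0, 1:] dvd res1 wu" and
    v: "\<phi> v - v = f ^ e * h * wv" "[:0, 1:] dvd res1 wv" by blast
  have "\<phi> (u * v) - u * v = (\<phi> u - u) * v + \<phi> u * (\<phi> v - v)"
    by (simp add: hom_mult algebra_simps)
  also have "\<dots> = f ^ e * h * (wu * v + \<phi> u * wv)"
    unfolding u v by (simp add: algebra_simps)
  finally show ?case
    using u v by (intro exI[of _ "wu * v + \<phi> u * wv"]) (simp add: dvd_add)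
qed

text \<open>A preimage would have the cofactor \<open>w = 1\<close>, which does not vanish at the
  origin.\<close>

lemma f_power_h_notin_pl:
  assumes w1: "\<phi> X1 - X1 = f ^ e * h * w1" "[:0, 1:] ^ 2 dvd res1 w1"
    and w2: "\<phi> X2 - X2 = f ^ e * h * w2" "[:0, 1:] ^ 2 dvd res1 w2"
  shows "f ^ e * h \<notin> pl \<phi>"
proof
  assume "f ^ e * h \<in> pl \<phi>"
  then obtain b where "\<phi> b - b = f ^ e * h"
    by (auto simp: pl_def)
  moreover obtain w where "\<phi> b - b = f ^ e * h * w" and w: "[:0, 1:] dvd res1 w"
    using diff_divisible[OF assms] by blast
  ultimately have "w = 1"
    using f_nonzero h_nonzero by simp
  with w obtain k :: "'a poly" where "1 = [:0, 1:] * k"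
    by (auto elim: dvdE)
  from arg_cong[OF this, of "\<lambda>q. poly q 0"] show False by simp
qed

text \<open>Apply \<open>\<phi>\<close> to \<open>X1 * g = f ^ (l * t + 1) + r ^ t\<close> and to
  \<open>f ^ l * X2 = r - X1 ^ m\<close>, then cancel \<open>g\<close> and \<open>f ^ l\<close>.
  \<open>S1\<close> and \<open>S2\<close> are the difference quotients of the \<open>t\<close>-th
  and \<open>m\<close>-th powers.\<close>

lemma X1_X2_diff:
  obtains S1 S2 Q1 Q2 where
    "\<phi> X1 - X1 = f ^ l * h * S1" "S1 = of_nat t * r ^ (t - 1) + s * Q1"
    "\<phi> X2 - X2 = h * (g - S1 * S2)" "S2 = of_nat m * X1 ^ (m - 1) + f ^ l * h * S1 * Q2"
proof -
  have r_diff: "\<phi> r - r = s"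
    by (simp add: hom_simps)
  obtain S1 Q1 where S1: "\<phi> r ^ t - r ^ t = s * S1" "S1 = of_nat t * r ^ (t - 1) + s * Q1"
    using power_diff_second_order[of "\<phi> r" t r] unfolding r_diff by blast
  have "g * (\<phi> X1 - X1) = \<phi> (X1 * g) - X1 * g"
    by (simp add: hom_mult fix_g algebra_simps)
  also have "\<dots> = \<phi> r ^ t - r ^ t"
    unfolding X1_g by (simp add: hom_add hom_mult hom_power fix_f)
  also have "\<dots> = g * (f ^ l * h * S1)"
    unfolding S1(1) by (simp add: mult_ac)
  finally have 1: "\<phi> X1 - X1 = f ^ l * h * S1"
    using g_nonzero by simp
  obtain S2 Q2 where S2: "\<phi> X1 ^ m - X1 ^ m = f ^ l * h * S1 * S2"
      "S2 = of_nat m * X1 ^ (m - 1) + f ^ l * h * S1 * Q2"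
    using power_diff_second_order[of "\<phi> X1" m X1] unfolding 1 by blast
  have fX2: "f ^ l * X2 = r - X1 ^ m"
    by (simp add: rpol_def)
  have "f ^ l * (\<phi> X2 - X2) = \<phi> (f ^ l * X2) - f ^ l * X2"
    by (simp add: hom_mult fix_fl algebra_simps)
  also have "\<dots> = s - (\<phi> X1 ^ m - X1 ^ m)"
    unfolding fX2 by (simp add: hom_simps)
  also have "\<dots> = f ^ l * (h * (g - S1 * S2))"
    unfolding S2(1) by (simp add: algebra_simps)
  finally have "\<phi> X2 - X2 = h * (g - S1 * S2)"
    using f_nonzero by simp
  with 1 S1 S2 that show thesis by blast
qed

text \<open>On the axis, \<open>g - S1 * S2\<close> is \<open>1 - t * m\<close> times a power with
  exponent \<open>m * t - 1\<close>, and \<open>m * t \<ge> 3\<close> makes this exponent at least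
  2.\<close>

lemma h_notin_pl: "h \<notin> pl \<phi>"
proof -
  obtain S1 S2 Q1 Q2 where
    1: "\<phi> X1 - X1 = f ^ l * h * S1" "S1 = of_nat t * r ^ (t - 1) + s * Q1" and
    2: "\<phi> X2 - X2 = h * (g - S1 * S2)" "S2 = of_nat m * X1 ^ (m - 1) + f ^ l * h * S1 * Q2"
    by (rule X1_X2_diff)
  have res_f: "res1 (f ^ l) = 0"
    using params t_ge_1 by (simp add: zero_power)
  have res_S1: "res1 S1 = of_nat t * [:0, 1:] ^ (m * (t - 1))"
    using params t_ge_1 res_f unfolding 1(2) by (simp add: power_mult)
  have res_S2: "res1 S2 = of_nat m * [:0, 1:] ^ (m - 1)"
    using res_f unfolding 2(2) by simp
  have "m * (t - 1) + (m - 1) = m * t - 1"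
    using params by (cases m; cases t) auto
  then have pow: "[:0, 1:] ^ (m * t - 1) = ([:0, 1:] ^ (m * (t - 1)) * [:0, 1:] ^ (m - 1) :: 'a poly)"
    by (simp only: power_add[symmetric])
  have "res1 (S1 * S2) = of_nat t * of_nat m * [:0, 1:] ^ (m * t - 1)"
    unfolding res1_simps(3) res_S1 res_S2 pow by (simp only: mult_ac)
  then have "res1 (g - S1 * S2)
      = [:0, 1:] ^ (m * t - 1) - of_nat t * of_nat m * [:0, 1:] ^ (m * t - 1)"
    using params t_ge_1 by (simp only: res1_simps(2) res1_gpol)
  moreover have "[:0, 1:] ^ 2 dvd ([:0, 1:] ^ (m * t - 1) :: 'a poly)"
    using params by (intro le_imp_power_dvd) simp
  ultimately have "[:0, 1:] ^ 2 dvd res1 (g - S1 * S2)"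
    by (simp only: dvd_diff dvd_mult)
  moreover have "\<phi> X1 - X1 = f ^ 0 * h * (f ^ l * S1)" "\<phi> X2 - X2 = f ^ 0 * h * (g - S1 * S2)"
    unfolding 1(1) 2(1) by (simp_all add: mult_ac)
  moreover have "[:0, 1:] ^ 2 dvd res1 (f ^ l * S1)"
    using res_f by (simp only: res1_simps(3)) simp
  ultimately have "f ^ 0 * h \<notin> pl \<phi>"
    using f_power_h_notin_pl by blast
  then show ?thesis by simp
qed

text \<open>When \<open>m t = 1\<close> in \<open>k\<close>, the leading term of \<open>g\<close> modulo \<open>f\<^sup>l\<close> cancels that of the shift of \<open>x\<^sub>2\<close>,
  so the automorphism is trivial modulo \<open>f\<^sup>l\<close>.\<close>
lemma fl_h_notin_pl:
  assumes "p dvd m * t - 1"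
  shows "f ^ l * h \<notin> pl \<phi>"
proof -
  obtain S1 S2 Q1 Q2 where
    1: "\<phi> X1 - X1 = f ^ l * h * S1" "S1 = of_nat t * r ^ (t - 1) + s * Q1" and
    2: "\<phi> X2 - X2 = h * (g - S1 * S2)" "S2 = of_nat m * X1 ^ (m - 1) + f ^ l * h * S1 * Q2"
    by (rule X1_X2_diff)
  obtain q :: "'a mpoly3" where q: "g = f ^ (l * t) * X3
    + X1 ^ (m - 1) * (r ^ (t - 1) + f ^ l * X2 * q)"
    using gpol_expansion[of l m t] params t_ge_1 by blast
  have "of_nat (m * t - 1) = (0 :: 'a mpoly3)"
    using assms by (simp add: of_nat_mpoly3_eq_0_iff char)
  then have "of_nat (m * t - 1 + 1) = (1 :: 'a mpoly3)"
    by (simp only: of_nat_add of_nat_1 add_0)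
  then have mt1: "of_nat t * of_nat m = (1 :: 'a mpoly3)"
    using params by (simp add: mult.commute)
  \<comment> \<open>\<open>G\<close> and \<open>W\<close> are the quotients by \<open>f ^ l\<close>
    of \<open>g - X1 ^ (m - 1) * r ^ (t - 1)\<close> and of \<open>g - S1 * S2\<close>.\<close>
  define G where "G = f ^ (l * (t - 1)) * X3 + X1 ^ (m - 1) * X2 * q"
  define W where "W = G - (g * h * Q1 * S2 + of_nat t * r ^ (t - 1) * (h * S1 * Q2))"
  have "l * t = l + l * (t - 1)"
    using t_ge_1 by (cases t) auto
  then have "f ^ (l * t) = f ^ l * f ^ (l * (t - 1))"
    by (simp only: power_add)
  then have gG: "g = X1 ^ (m - 1) * r ^ (t - 1) + f ^ l * G"
    unfolding G_def by (subst q) (simp add: algebra_simps)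
  have "S1 * S2 = of_nat t * r ^ (t - 1) * S2 + s * Q1 * S2"
    by (subst 1(2)) (simp add: algebra_simps)
  also have "of_nat t * r ^ (t - 1) * S2 = (of_nat t * of_nat m) * (X1 ^ (m - 1) * r ^ (t - 1))
      + f ^ l * (of_nat t * r ^ (t - 1) * (h * S1 * Q2))"
    by (subst 2(2)) (simp add: algebra_simps)
  finally have "g - S1 * S2 = f ^ l * W"
    unfolding mt1 W_def by (subst (1) gG) (simp add: algebra_simps)
  then have X2_diff: "\<phi> X2 - X2 = f ^ l * h * W"
    using 2(1) by simp
  have res_f: "res1 (f ^ l) = 0"
    using params t_ge_1 by (simp add: zero_power)
  \<comment> \<open>For \<open>m = 1\<close> the bound rests on \<open>m * t \<ge> 3\<close>, which
    forces \<open>t \<ge> 3\<close>.\<close>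
  have "2 \<le> m * (t - 1)"
  proof (cases "m = 1")
    case False
    with params have "2 * 1 \<le> m * (t - 1)"
      by (intro mult_le_mono) auto
    then show ?thesis by simp
  qed (use params in simp)
  then have "[:0, 1:] ^ 2 dvd ([:0, 1:] ^ (m * (t - 1)) :: 'a poly)"
    by (rule le_imp_power_dvd)
  then have S1: "[:0, 1:] ^ 2 dvd res1 S1"
    using res_f params t_ge_1 unfolding 1(2) by (simp add: power_mult zero_power)
  have "[:0, 1:] ^ 2 dvd res1 g"
    using params t_ge_1 by (simp add: le_imp_power_dvd)
  moreover have "res1 G = 0"
    using params by (simp add: G_def zero_power)
  ultimately have "[:0, 1:] ^ 2 dvd res1 W"
    using S1 unfolding W_def by (simp only: res1_simps) (simp add: dvd_add)
  with f_power_h_notin_pl[OF 1(1) S1 X2_diff] show ?thesis by blast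
qed

lemma not_principal:
  assumes "\<not> p dvd t"
  shows "\<not> principal_in (fixring \<phi>) (pl \<phi>)"
proof
  assume princ: "principal_in (fixring \<phi>) (pl \<phi>)"
  obtain J where J: "f ^ (J + l) * h \<in> pl \<phi>"
    using f_power_h_in_pl[OF assms] by blast
  show False
  proof (cases "p dvd m * t - 1")
    case True
    have "f ^ l * h \<in> pl \<phi>"
      using principal_absorb[OF princ J, of 1] s_in_pl by simp
    with fl_h_notin_pl[OF True] show False by blast
  next
    case False
    then obtain n where "g ^ n * h \<in> pl \<phi>"
      using g_power_h_in_pl by blast
    then have "h \<in> pl \<phi>"
      using principal_absorb[OF princ, of "J + l" 0 n] J by simp
    with h_notin_pl show False by blast
  qed
qed

section \<open>The plinth ideal when \<open>p\<close> divides \<open>t\<close>\<close>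

lemma gh_dvd_diff:
  assumes "p dvd t"
  shows "g * h dvd \<phi> b - b"
proof -
  have t0: "of_nat t = (0 :: 'a mpoly3)" "of_nat t = (0 :: 'a)"
    using assms by (simp_all add: of_nat_eq_0_iff_char_dvd char)
  obtain S1 S2 Q1 Q2 where
    1: "\<phi> X1 - X1 = f ^ l * h * S1" "S1 = of_nat t * r ^ (t - 1) + s * Q1" and
    2: "\<phi> X2 - X2 = h * (g - S1 * S2)" "S2 = of_nat m * X1 ^ (m - 1) + f ^ l * h * S1 * Q2"
    by (rule X1_X2_diff)
  \<comment> \<open>The leading term of \<open>S1\<close> vanishes with \<open>t\<close>, so
    \<open>S1\<close> gains the factor \<open>g\<close> of \<open>s\<close>.\<close>
  have S1: "S1 = s * Q1"
    using 1(2) t0 by simp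
  define u1 where "u1 = f ^ l * (f ^ l * h * Q1)"
  define u2 where "u2 = 1 - f ^ l * h * Q1 * S2"
  have X1: "\<phi> X1 - X1 = h * (g * u1)"
    unfolding 1(1) S1 u1_def by (simp add: mult_ac)
  have X2: "\<phi> X2 - X2 = h * (g * u2)"
    unfolding 2(1) S1 u2_def by (simp add: algebra_simps)
  show ?thesis
  proof (induction b rule: mpoly3_induct)
    case (const c)
    show ?case by (simp add: hom_const)
  next
    case X1
    show ?case unfolding \<open>\<phi> X1 - X1 = h * (g * u1)\<close> by (simp add: mult.left_commute mult.commute)
  next
    case X2
    show ?case unfolding \<open>\<phi> X2 - X2 = h * (g * u2)\<close> by (simp add: mult.left_commute mult.commute)
  next
    case X3
    obtain v where v: "\<phi> X3 - X3 = h * v"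
      using h_dvd by (blast elim: dvdE)
    obtain S where "X1 * v = (g * u2) * S - (g * u1) * \<phi> X3"
      using X1_mult_X3_diff[OF X1 X2 v] by blast
    then have "g dvd X1 * v"
      by (simp add: dvd_diff)
    then have "g dvd v"
      using prime_elem_dvd_cancel[OF prime_elem_X1] not_X1_dvd_gpol params(1,2) t_ge_1 t0(2) by blast
    then show ?case
      unfolding v by (simp add: mult.commute mult_dvd_mono)
  next
    case (add u v)
    have "\<phi> (u + v) - (u + v) = (\<phi> u - u) + (\<phi> v - v)"
      by (simp add: hom_add)
    with add show ?case by (simp only: dvd_add)
  next
    case (mult u v)
    have "\<phi> (u * v) - u * v = (\<phi> u - u) * v + \<phi> u * (\<phi> v - v)"
      by (simp add: hom_mult algebra_simps)
    with mult show ?case by (simp only: dvd_add dvd_mult dvd_mult2)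
  qed
qed

text \<open>If \<open>p\<close> divides \<open>t\<close>, then \<open>r\<^sup>t\<close> and hence \<open>x\<^sub>1\<close> are congruent to invariants modulo \<open>f\<^sup>l\<close>.
  Replacing \<open>x\<^sub>1\<close> by such an invariant \<open>y\<close> in \<open>x\<^sub>2 = (r - x\<^sub>1\<^sup>m) / f\<^sup>l\<close> yields an element shifted by \<open>g h\<close>.\<close>
lemma gh_is_diff:
  assumes "p dvd t"
  obtains b where "\<phi> b - b = g * h"
proof -
  obtain t' where t': "t = p * t'"
    using assms ..
  have "f ^ l * g dvd r ^ p - N"
    using dvd_mult_left[OF N_cong] unfolding minus_diff_eq[of N "r ^ p", symmetric] dvd_minus_iff .
  then have "f ^ l * g dvd (r ^ p) ^ t' - N ^ t'"
    by (rule dvd_diff_power)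
  then obtain Q where "(r ^ p) ^ t' - N ^ t' = f ^ l * g * Q" ..
  then have Q: "r ^ t - N ^ t' = f ^ l * g * Q"
    by (simp add: t' power_mult)
  \<comment> \<open>This makes \<open>g * y\<close> the expression for \<open>X1 * g\<close> with
    \<open>r ^ t\<close> replaced by the invariant \<open>N ^ t'\<close>; cancelling
    \<open>g\<close> shows that \<open>y\<close> is invariant.\<close>
  define y where "y = X1 - f ^ l * Q"
  have "g * y = X1 * g - f ^ l * g * Q"
    by (simp add: y_def algebra_simps)
  also have "\<dots> = f ^ (l * t + 1) + N ^ t'"
    unfolding X1_g Q[symmetric] by simp
  finally have "\<phi> (g * y) = g * y"
    by (simp add: hom_add hom_mult hom_power fix_f fix_N)
  then have y: "\<phi> y = y"
    using fix_cancel[OF fix_g _ g_nonzero] by blast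
  have "f ^ l dvd X1 ^ m - y ^ m"
    by (intro dvd_diff_power) (simp add: y_def)
  then obtain z where z: "X1 ^ m - y ^ m = f ^ l * z" ..
  have b: "f ^ l * (X2 + z) = r - y ^ m"
    using z by (simp add: rpol_def algebra_simps)
  have "f ^ l * (\<phi> (X2 + z) - (X2 + z)) = \<phi> (f ^ l * (X2 + z)) - f ^ l * (X2 + z)"
    by (simp add: hom_add hom_mult fix_fl algebra_simps)
  also have "\<dots> = f ^ l * (g * h)"
    unfolding b by (simp add: hom_diff hom_power y shift_r)
  finally have "\<phi> (X2 + z) - (X2 + z) = g * h"
    using f_nonzero by simp
  then show thesis by (rule that)
qed

lemma pl_eq:
  assumes "p dvd t"
  shows "pl \<phi> = {g * h * c | c. c \<in> fixring \<phi>}"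
proof (intro equalityI subsetI)
  fix d assume "d \<in> pl \<phi>"
  then obtain b where b: "d = \<phi> b - b" and d: "\<phi> d = d"
    by (auto simp: pl_def fixring_def)
  obtain c where c: "d = g * h * c"
    using gh_dvd_diff[OF assms, of b] b by (blast elim: dvdE)
  have "\<phi> (g * h) = g * h"
    by (simp add: hom_simps)
  then have "\<phi> c = c"
    using fix_cancel[of "g * h" c] d g_nonzero h_nonzero unfolding c by simp
  with c show "d \<in> {g * h * c | c. c \<in> fixring \<phi>}"
    by (auto simp: fixring_def)
next
  fix d assume "d \<in> {g * h * c | c. c \<in> fixring \<phi>}"
  then obtain c where d: "d = g * h * c" and c: "\<phi> c = c"
    by (auto simp: fixring_def)
  obtain b where b: "\<phi> b - b = g * h"
    using gh_is_diff[OF assms] .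
  have "\<phi> (b * c) - b * c = d"
    unfolding d b[symmetric] by (simp add: hom_mult c algebra_simps)
  then show "d \<in> pl \<phi>"
    by (rule plI) (simp add: d hom_mult c fix_g fix_h)
qed

end

section \<open>From the action to the automorphism\<close>

theorem theorem4p3:
  fixes \<epsilon> :: "'a::field mpoly3 \<Rightarrow> 'a mpoly3 poly"
    and l m t p :: nat and h :: "'a mpoly3"
  assumes "CHAR('a) = p" and "p > 0"
    and "l \<ge> 1" and "m \<ge> 1" and "t \<ge> 2" and "m * t \<ge> 3"
    and "kalg_hom_T \<epsilon>"
    and "\<epsilon> (fpol t) = [:fpol t:]"
    and "\<epsilon> (gpol l m t) = [:gpol l m t:]"
    and "\<epsilon> (rpol l m t) = [:rpol l m t, fpol t ^ l * gpol l m t:]"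
    and "h \<in> invariants \<epsilon>" and "h \<noteq> 0"
  shows "(\<not> p dvd t \<longrightarrow> \<not> principal_in (fixring (eps_at \<epsilon> h)) (pl (eps_at \<epsilon> h)))
       \<and> (p dvd t \<longrightarrow> pl (eps_at \<epsilon> h) = {gpol l m t * h * c | c. c \<in> fixring (eps_at \<epsilon> h)})"
proof -
  note [simp] = assms(8,9,10)
  have add: "\<epsilon> (u + v) = \<epsilon> u + \<epsilon> v" and mult: "\<epsilon> (u * v) = \<epsilon> u * \<epsilon> v"
    and one: "\<epsilon> 1 = 1" and const: "\<epsilon> (const3 c) = [:const3 c:]" for u v c
    using assms(7) by (auto simp: kalg_hom_T_def)
  have power: "\<epsilon> (u ^ n) = \<epsilon> u ^ n" for u n
    by (induction n) (simp_all add: one mult)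
  have "t \<ge> 1"
    using assms by simp
  note f0 = fpol_nonzero[OF \<open>t \<ge> 1\<close>, where ?'a = 'a]
    and g0 = gpol_nonzero[OF assms(3,4) \<open>t \<ge> 1\<close>, where ?'a = 'a]
  \<comment> \<open>Known for \<open>f\<close>, \<open>g\<close> and \<open>r\<close>; their
    relations carry it to \<open>X1\<close>, \<open>X2\<close> and \<open>X3\<close> on cancelling
    \<open>g\<close>, \<open>f ^ l\<close> and \<open>X1\<close>.\<close>
  have eps_0: "poly (\<epsilon> b) 0 = b" for b
  proof -
    have X1: "poly (\<epsilon> X1) 0 = X1"
    proof -
      have "poly (\<epsilon> (X1 * gpol l m t)) 0 = X1 * gpol l m t"
        unfolding X1_mult_gpol[OF assms(3,4)] by (simp only: add power) simp
      then show ?thesis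
        using g0 by (simp add: mult)
    qed
    have X2: "poly (\<epsilon> X2) 0 = X2"
    proof -
      have "poly (\<epsilon> (fpol t ^ l * X2 + X1 ^ m)) 0 = fpol t ^ l * X2 + X1 ^ m"
        unfolding rpol_def[symmetric] by simp
      then show ?thesis
        using f0 by (simp add: add mult power X1)
    qed
    have X3: "poly (\<epsilon> X3) 0 = X3"
    proof -
      have eq: "X1 * X3 = (fpol t + X2 ^ t :: 'a mpoly3)"
        by (simp add: fpol_def)
      have "poly (\<epsilon> (X1 * X3)) 0 = X1 * X3"
        unfolding eq by (simp add: add power X2)
      then show ?thesis
        using X1_nonzero[where ?'a = 'a] by (simp add: mult X1)
    qed
    show ?thesis
      by (induction b rule: mpoly3_induct) (simp_all add: X1 X2 X3 add mult const)
  qed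
  interpret freudenburg_automorphism "eps_at \<epsilon> h" l m t p h
  proof
    fix b
    \<comment> \<open>The constant coefficient is \<open>b\<close>, so evaluation at
      \<open>h\<close> changes \<open>b\<close> by a multiple of \<open>h\<close>.\<close>
    obtain c q where q: "\<epsilon> b = pCons c q"
      by (rule pCons_cases)
    with eps_0[of b] have "c = b" by simp
    with q show "h dvd eps_at \<epsilon> h b - b"
      by (simp add: eps_at_def)
  qed (use assms in \<open>simp_all add: eps_at_def add mult const invariants_def mult.commute\<close>)
  show ?thesis
    using not_principal pl_eq by blast
qed

end
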